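(* Let $n\geq 7$. Then every line-like crescent configuration in $L^\infty$ of size $n$ is a perpendicular perturbation of a horizontal or vertical line.
   Context: The $L^\infty$ norm on $\mathbb{R}^2$ is $\|(x,y)\|_\infty=\max\{|x|,|y|\}$; an $L^\infty$ circle is a set $\{q:\|q-p\|_\infty=r\}$ with $p\in\mathbb{R}^2$, $r>0$ (the boundary of an axis-parallel square). A set $S\subset\mathbb{R}^2$ of $n$ points is a line-like configuration in $L^\infty$ if its distance graph is isomorphic to that of $n$ equally spaced points on a line, i.e. there is a bijection $\phi: S\to\{1,\dots,n\}$ such that for all $a,b,c,d\in S$: $\|a-b\|_\infty=\|c-d\|_\infty$ if and only if $|\phi(a)-\phi(b)|=|\phi(c)-\phi(d)|$. It is a line-like crescent configuration in $L^\infty$ of size $n$ if, in addition, no three of its points lie on a common line and no four of its points lie on a common $L^\infty$ circle. A set of $n$ points is a perpendicular perturbation of a line $\ell$ if its points can be enumerated as $P_1,\dots,P_n$ so that there exist (distinct) equally spaced points $Q_1,\dots,Q_n$ on $\ell$, i.e. $Q_i=Q_1+(i-1)v$ for some nonzero vector $v$ parallel to $\ell$, such that for every $i$ the orthogonal projection of $P_i$ onto $\ell$ is $Q_i$. *)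

theory Defs
  imports "HOL-Analysis.Analysis"
begin

text \<open>The library's \<^const>\<open>infnorm\<close>, specialised to the plane, is the usual maximum norm.\<close>

lemma infnorm_real2: "infnorm (x :: real^2) = max \<bar>x $ 1\<bar> \<bar>x $ 2\<bar>"
proof -
  have "{\<bar>x $ i\<bar> | i. i \<in> UNIV} = {\<bar>x $ 1\<bar>, \<bar>x $ 2\<bar>}"
    by (auto simp: exhaust_2) (metis exhaust_2)
  then show ?thesis
    by (simp add: infnorm_cart cSup_eq_Max)
qed

definition Linf_circle :: "(real^2) set \<Rightarrow> bool" where
  "Linf_circle C \<longleftrightarrow> (\<exists>p r. r > 0 \<and> C = {q. infnorm (q - p) = r})"

definition line_like_config :: "nat \<Rightarrow> (real^2) set \<Rightarrow> bool" where
  "line_like_config n S \<longleftrightarrow> finite S \<and> card S = n \<and>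
     (\<exists>\<phi> :: real^2 \<Rightarrow> nat. bij_betw \<phi> S {1..n} \<and>
       (\<forall>a\<in>S. \<forall>b\<in>S. \<forall>c\<in>S. \<forall>d\<in>S.
          infnorm (a - b) = infnorm (c - d) \<longleftrightarrow>
          \<bar>int (\<phi> a) - int (\<phi> b)\<bar> = \<bar>int (\<phi> c) - int (\<phi> d)\<bar>))"

definition line_like_crescent_config :: "nat \<Rightarrow> (real^2) set \<Rightarrow> bool" where
  "line_like_crescent_config n S \<longleftrightarrow> line_like_config n S \<and>
     (\<forall>T\<subseteq>S. card T = 3 \<longrightarrow> \<not> collinear T) \<and>
     (\<forall>T\<subseteq>S. card T = 4 \<longrightarrow> \<not> (\<exists>C. Linf_circle C \<and> T \<subseteq> C))"

definition is_line :: "(real^2) set \<Rightarrow> bool" where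
  "is_line l \<longleftrightarrow> affine l \<and> aff_dim l = 1"

definition horizontal_line :: "(real^2) set \<Rightarrow> bool" where
  "horizontal_line l \<longleftrightarrow> (\<exists>c. l = {p. p $ 2 = c})"

definition vertical_line :: "(real^2) set \<Rightarrow> bool" where
  "vertical_line l \<longleftrightarrow> (\<exists>c. l = {p. p $ 1 = c})"

definition orthogonal_projection :: "(real^2) set \<Rightarrow> real^2 \<Rightarrow> real^2 \<Rightarrow> bool" where
  "orthogonal_projection l p q \<longleftrightarrow> q \<in> l \<and> (\<forall>x\<in>l. orthogonal (p - q) (x - q))"

text \<open>The condition \<open>\<forall>x\<in>l. x + v \<in> l\<close> says that \<open>v\<close> is parallel to the line \<open>l\<close>.
  As \<open>v \<noteq> 0\<close>, the points \<open>Q i\<close> are automatically distinct.\<close>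

definition perpendicular_perturbation :: "nat \<Rightarrow> (real^2) set \<Rightarrow> (real^2) set \<Rightarrow> bool" where
  "perpendicular_perturbation n S l \<longleftrightarrow> is_line l \<and>
     (\<exists>(P :: nat \<Rightarrow> real^2) (Q :: nat \<Rightarrow> real^2) v.
        bij_betw P {1..n} S \<and>
        v \<noteq> 0 \<and> (\<forall>x\<in>l. x + v \<in> l) \<and>
        (\<forall>i\<in>{1..n}. Q i \<in> l \<and> Q i = Q 1 + (real i - 1) *\<^sub>R v) \<and>
        (\<forall>i\<in>{1..n}. orthogonal_projection l (P i) (Q i)))"

lemma horizontal_line_is_line: "horizontal_line l \<Longrightarrow> is_line l"
proof -
  assume "horizontal_line l"
  then obtain c where "l = {p. p $ 2 = c}" by (auto simp: horizontal_line_def)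
  then have "l = {p. axis 2 1 \<bullet> p = c}" by (simp add: inner_axis')
  then show "is_line l"
    by (simp add: is_line_def affine_hyperplane aff_dim_hyperplane axis_eq_0_iff)
qed

lemma vertical_line_is_line: "vertical_line l \<Longrightarrow> is_line l"
proof -
  assume "vertical_line l"
  then obtain c where "l = {p. p $ 1 = c}" by (auto simp: vertical_line_def)
  then have "l = {p. axis 1 1 \<bullet> p = c}" by (simp add: inner_axis')
  then show "is_line l"
    by (simp add: is_line_def affine_hyperplane aff_dim_hyperplane axis_eq_0_iff)
qed

end

theory Submission
  imports Defs
begin

text \<open>
  Let \<open>d k\<close> be the distance of two points whose indices differ by \<open>k\<close>. Each step from a point to the
  next one lies on the square of radius \<open>d 1\<close>, hence on its right, left, top or bottom side; the
  claim is that all steps can be taken on the same side. Among seven consecutive points, if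
  \<open>d 2 = 2 * d 1\<close>, then consecutive steps share a side, and a change of side needs a corner step,
  which is incompatible with the third distance. If \<open>d 2 < 2 * d 1\<close>, consecutive steps
  never share a side; up to the symmetries of the square and reversal of the order, twelve words in
  the four sides are contradictory, and every word of length six contains one of them. Windows of
  seven points overlap in more than one step, and two overlapping steps along the same diagonal
  would give three collinear points, so all windows use the same side.
\<close>

(* Points and distances are indexed by numerals, which must not be rewritten to Suc 0. *)
declare One_nat_def [simp del] One_nat_def [symmetric, simp]

section \<open>Indexed point sequences with prescribed distances\<close>

abbreviation linf :: "(nat \<Rightarrow> real) \<Rightarrow> (nat \<Rightarrow> real) \<Rightarrow> nat \<Rightarrow> nat \<Rightarrow> real" where
  "linf f g i j \<equiv> max \<bar>f j - f i\<bar> \<bar>g j - g i\<bar>"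

text \<open>
  The points are \<open>(f i, g i)\<close> for \<open>i = 0, \<dots>, m\<close>; the last clause forbids three of them on a line
  \<open>u * x + v * y = c\<close>.
\<close>

definition linf_line :: "nat \<Rightarrow> (nat \<Rightarrow> real) \<Rightarrow> (nat \<Rightarrow> real) \<Rightarrow> (nat \<Rightarrow> real) \<Rightarrow> bool" where
  "linf_line m d f g \<longleftrightarrow>
     inj_on d {1..m} \<and> (\<forall>k\<in>{1..m}. 0 < d k) \<and>
     (\<forall>i j. i < j \<longrightarrow> j \<le> m \<longrightarrow> linf f g i j = d (j - i)) \<and>
     (\<forall>i j k u v c. i < j \<longrightarrow> j < k \<longrightarrow> k \<le> m \<longrightarrow>
        u * f i + v * g i = c \<longrightarrow> u * f j + v * g j = c \<longrightarrow> u * f k + v * g k = c \<longrightarrow>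
        u = 0 \<and> v = 0)"

lemma linf_line_dist:
  "linf_line m d f g \<Longrightarrow> i < j \<Longrightarrow> j \<le> m \<Longrightarrow> linf f g i j = d (j - i)"
  by (simp add: linf_line_def)

lemma linf_line_pos: "linf_line m d f g \<Longrightarrow> 1 \<le> k \<Longrightarrow> k \<le> m \<Longrightarrow> 0 < d k"
  by (simp add: linf_line_def)

lemma linf_line_inj_on: "linf_line m d f g \<Longrightarrow> inj_on d {1..m}"
  by (simp add: linf_line_def)

lemma linf_line_inj:
  "linf_line m d f g \<Longrightarrow> k \<noteq> l \<Longrightarrow> 1 \<le> k \<Longrightarrow> 1 \<le> l \<Longrightarrow> k \<le> m \<Longrightarrow> l \<le> m \<Longrightarrow> d k \<noteq> d l"
  using inj_onD[OF linf_line_inj_on, of m d f g k l] by auto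

lemma linf_line_on_line:
  assumes "linf_line m d f g" "i < j" "j < k" "k \<le> m"
    "u * f i + v * g i = c" "u * f j + v * g j = c" "u * f k + v * g k = c"
  shows "u = 0 \<and> v = 0"
  using assms unfolding linf_line_def by blast

lemma linf_lineI:
  assumes "inj_on d {1..m}" "\<And>k. 1 \<le> k \<Longrightarrow> k \<le> m \<Longrightarrow> 0 < d k"
    "\<And>i j. i < j \<Longrightarrow> j \<le> m \<Longrightarrow> linf f g i j = d (j - i)"
    "\<And>i j k u v c. i < j \<Longrightarrow> j < k \<Longrightarrow> k \<le> m \<Longrightarrow>
       u * f i + v * g i = c \<Longrightarrow> u * f j + v * g j = c \<Longrightarrow> u * f k + v * g k = c \<Longrightarrow>
       u = 0 \<and> v = 0"
  shows "linf_line m d f g"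
  unfolding linf_line_def using assms by (auto 0 0)

lemma linf_line_noncollinear:
  assumes "linf_line m d f g" "i < j" "j < k" "k \<le> m"
  shows "\<not> (f i = f j \<and> f j = f k)" "\<not> (g i = g j \<and> g j = g k)"
    "\<not> (f i + g i = f j + g j \<and> f j + g j = f k + g k)"
    "\<not> (f i - g i = f j - g j \<and> f j - g j = f k - g k)"
proof -
  note * = linf_line_on_line[OF assms]
  show "\<not> (f i = f j \<and> f j = f k)" using *[of 1 0 "f i"] by force
  show "\<not> (g i = g j \<and> g j = g k)" using *[of 0 1 "g i"] by force
  show "\<not> (f i + g i = f j + g j \<and> f j + g j = f k + g k)"
    using *[of 1 1 "f i + g i"] by force
  show "\<not> (f i - g i = f j - g j \<and> f j - g j = f k - g k)"
    using *[of 1 "-1" "f i - g i"] by force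
qed

section \<open>Symmetries of the square and of the indexing\<close>

lemma linf_line_swap:
  assumes "linf_line m d f g"
  shows "linf_line m d g f"
proof (rule linf_lineI)
  fix i j k u v c
  assume "i < j" "j < k" "k \<le> m"
    "u * g i + v * f i = c" "u * g j + v * f j = c" "u * g k + v * f k = c"
  then show "u = 0 \<and> v = 0"
    using linf_line_on_line[OF assms, of i j k v u c] by (simp add: add.commute)
next
  fix i j assume "i < j" "j \<le> m"
  then show "linf g f i j = d (j - i)"
    using linf_line_dist[OF assms, of i j] by (simp add: max.commute)
qed (use linf_line_inj_on[OF assms] in \<open>simp_all add: linf_line_pos[OF assms]\<close>)

lemma linf_line_uminus1:
  assumes "linf_line m d f g"
  shows "linf_line m d (\<lambda>i. - f i) g"
proof (rule linf_lineI)
  fix i j k u v c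
  assume "i < j" "j < k" "k \<le> m"
    "u * - f i + v * g i = c" "u * - f j + v * g j = c" "u * - f k + v * g k = c"
  then show "u = 0 \<and> v = 0"
    using linf_line_on_line[OF assms, of i j k "- u" v c] by simp
next
  fix i j assume "i < j" "j \<le> m"
  then show "linf (\<lambda>i. - f i) g i j = d (j - i)"
    using linf_line_dist[OF assms, of i j] by (simp add: abs_minus_commute)
qed (use linf_line_inj_on[OF assms] in \<open>simp_all add: linf_line_pos[OF assms]\<close>)

lemma linf_line_uminus2: "linf_line m d f g \<Longrightarrow> linf_line m d f (\<lambda>i. - g i)"
  by (rule linf_line_swap[OF linf_line_uminus1[OF linf_line_swap]])

lemma linf_line_shift:
  assumes "linf_line m d f g" "k + l \<le> m"
  shows "linf_line l d (\<lambda>i. f (k + i)) (\<lambda>i. g (k + i))"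
proof (rule linf_lineI)
  show "inj_on d {1..l}"
    using linf_line_inj_on[OF assms(1)] by (rule inj_on_subset) (use assms(2) in auto)
next
  fix i j assume "i < j" "j \<le> l"
  then show "linf (\<lambda>i. f (k + i)) (\<lambda>i. g (k + i)) i j = d (j - i)"
    using linf_line_dist[OF assms(1), of "k + i" "k + j"] assms(2) by simp
next
  fix i j n u v c
  assume "i < j" "j < n" "n \<le> l" "u * f (k + i) + v * g (k + i) = c"
    "u * f (k + j) + v * g (k + j) = c" "u * f (k + n) + v * g (k + n) = c"
  then show "u = 0 \<and> v = 0"
    using linf_line_on_line[OF assms(1), of "k + i" "k + j" "k + n" u v c] assms(2) by simp
qed (use assms(2) linf_line_pos[OF assms(1)] in simp)

text \<open>Negating both coordinates while reversing the order keeps the side of every step, so a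
  word of sides is merely read backwards.\<close>

lemma linf_line_reverse:
  assumes "linf_line m d f g"
  shows "linf_line m d (\<lambda>i. - f (m - i)) (\<lambda>i. - g (m - i))"
proof (rule linf_lineI)
  fix i j assume "i < j" "j \<le> m"
  then show "linf (\<lambda>i. - f (m - i)) (\<lambda>i. - g (m - i)) i j = d (j - i)"
    using linf_line_dist[OF assms, of "m - j" "m - i"] by simp
next
  fix i j k u v c
  assume "i < j" "j < k" "k \<le> m" "u * - f (m - i) + v * - g (m - i) = c"
    "u * - f (m - j) + v * - g (m - j) = c" "u * - f (m - k) + v * - g (m - k) = c"
  then show "u = 0 \<and> v = 0"
    using linf_line_on_line[OF assms, of "m - k" "m - j" "m - i" u v "- c"] by simp
qed (use linf_line_inj_on[OF assms] in \<open>simp_all add: linf_line_pos[OF assms]\<close>)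

section \<open>Steps on the sides of the square of radius \<open>d 1\<close>\<close>

lemma linf_line_step:
  assumes "linf_line m d f g" "j = i + 1" "j \<le> m"
  obtains "f j = f i + d 1" | "f j = f i - d 1" | "g j = g i + d 1" | "g j = g i - d 1"
  using linf_line_dist[OF assms(1), of i j] assms(2,3) by simp linarith

text \<open>Two such steps would change one coordinate by \<open>2 * d 1\<close>, more than
  \<open>d 2\<close>.\<close>

lemma no_repeat:
  assumes "linf_line m d f g" "d 2 < 2 * d 1" "j = i + 1" "k = i + 2" "k \<le> m"
  shows "\<not> (f j = f i + d 1 \<and> f k = f j + d 1)" "\<not> (f j = f i - d 1 \<and> f k = f j - d 1)"
    "\<not> (g j = g i + d 1 \<and> g k = g j + d 1)" "\<not> (g j = g i - d 1 \<and> g k = g j - d 1)"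
  using linf_line_dist[OF assms(1), of i k] assms(2-5) by simp_all linarith+

section \<open>Twelve forbidden words of sides\<close>

text \<open>
  In the names below, the letters R, L, T, B stand for steps on the right, left, top and bottom side.
  The distances listed in each proof are the ones that contradict the given word.
\<close>

lemma no_TBTB:
  assumes L: "linf_line 4 d f g"
    and S: "g 1 = g 0 + d 1" "g 2 = g 1 - d 1" "g 3 = g 2 + d 1" "g 4 = g 3 - d 1"
  shows False
  using linf_line_noncollinear(2)[OF L, of 0 2 4] S by simp

text \<open>As \<open>f 1 = f 3\<close>, the heights \<open>g 1\<close> and \<open>g 3\<close>
  differ by \<open>d 2\<close>. If point 3 is lower, (0, 3) gives \<open>d 3 \<le> d 1\<close> and
  (1, 4) gives \<open>d 1 \<le> d 3\<close>, against injectivity. If it is higher,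
  \<open>d 3 = d 1 + d 2\<close> and \<open>g 2 = g 0 + d 2\<close>, and (1, 4) is too
  close.\<close>

lemma no_TRLR:
  assumes L: "linf_line 4 d f g" and d2: "d 2 < 2 * d 1"
    and S: "g 1 = g 0 + d 1" "f 2 = f 1 + d 1" "f 3 = f 2 - d 1" "f 4 = f 3 + d 1"
  shows False
proof -
  have "linf f g 0 1 = d 1" "linf f g 0 2 = d 2" "linf f g 0 3 = d 3" "linf f g 1 3 = d 2"
    "linf f g 1 4 = d 3" "linf f g 2 3 = d 1" "linf f g 2 4 = d 2"
    by (simp_all add: linf_line_dist[OF L])
  moreover have "d 1 \<noteq> d 3"
    by (rule linf_line_inj[OF L]) simp_all
  moreover have "0 < d 1" "0 < d 2" "0 < d 3"
    by (simp_all add: linf_line_pos[OF L])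
  ultimately show False
    using S d2 by (smt (z3))
qed

text \<open>As \<open>f 1 = f 3\<close>, the heights \<open>g 1\<close> and \<open>g 3\<close>
  differ by \<open>d 2\<close>. One of the pairs (0, 3), (1, 4) then has height difference
  \<open>d 1 + d 2\<close> and the other has distance at most \<open>d 1\<close>, although both have
  distance \<open>d 3\<close>.\<close>

lemma no_TRLB:
  assumes L: "linf_line 4 d f g" and d2: "d 2 < 2 * d 1"
    and S: "g 1 = g 0 + d 1" "f 2 = f 1 + d 1" "f 3 = f 2 - d 1" "g 4 = g 3 - d 1"
  shows False
proof -
  have "linf f g 0 1 = d 1" "linf f g 0 3 = d 3" "linf f g 1 3 = d 2" "linf f g 1 4 = d 3"
    "linf f g 3 4 = d 1"
    by (simp_all add: linf_line_dist[OF L])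
  moreover have "0 < d 1" "0 < d 2" "0 < d 3"
    by (simp_all add: linf_line_pos[OF L])
  ultimately show False
    using S d2 by (smt (z3))
qed

text \<open>The last step rises by less than \<open>d 1\<close>, so (1, 4) can match
  \<open>d 3 \<ge> g 3 - g 0\<close> only if both sides equal \<open>d 1\<close>. The other
  distances then make points 0 and 4 coincide.\<close>

lemma no_TRTL:
  assumes L: "linf_line 4 d f g" and d2: "d 2 < 2 * d 1"
    and S: "g 1 = g 0 + d 1" "f 2 = f 1 + d 1" "g 3 = g 2 + d 1" "f 4 = f 3 - d 1"
  shows False
proof -
  have "linf f g 0 1 = d 1" "linf f g 0 2 = d 2" "linf f g 0 3 = d 3" "linf f g 0 4 = d 4"
    "linf f g 1 2 = d 1" "linf f g 1 4 = d 3" "linf f g 2 3 = d 1" "linf f g 2 4 = d 2"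
    "linf f g 3 4 = d 1"
    by (simp_all add: linf_line_dist[OF L])
  moreover have "0 < d 1" "0 < d 2" "0 < d 3" "0 < d 4"
    by (simp_all add: linf_line_pos[OF L])
  ultimately show False
    using S d2 by (smt (z3))
qed

text \<open>As \<open>g 0 = g 2\<close> and \<open>f 2 = f 4\<close>, the pair (0, 4) takes its
  coordinate differences from (0, 2) and (2, 4), both of size \<open>d 2\<close>; hence
  \<open>d 4 = d 2\<close>.\<close>

lemma no_TBRL:
  assumes L: "linf_line 4 d f g" and d2: "d 2 < 2 * d 1"
    and S: "g 1 = g 0 + d 1" "g 2 = g 1 - d 1" "f 3 = f 2 + d 1" "f 4 = f 3 - d 1"
  shows False
proof -
  have "linf f g 0 2 = d 2" "linf f g 0 4 = d 4" "linf f g 2 4 = d 2"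
    by (simp_all add: linf_line_dist[OF L])
  moreover have "d 2 \<noteq> d 4"
    by (rule linf_line_inj[OF L]) simp_all
  moreover have "0 < d 1" "0 < d 2" "0 < d 4"
    by (simp_all add: linf_line_pos[OF L])
  ultimately show False
    using S d2 by (smt (z3))
qed

text \<open>If \<open>g 3 = g 1 + d 2\<close>, the pairs (0, 2) and (2, 4) cannot cover the height
  \<open>g 4 - g 0 = 2 * d 1 + d 2\<close>. If \<open>g 3 = g 1 - d 2\<close>, the distances give
  \<open>d 3 = d 2 - d 1\<close>, then \<open>g 5 = g 1\<close>, and finally
  \<open>d 5 = d 1\<close>.\<close>

lemma no_TRLTR:
  assumes L: "linf_line 5 d f g" and d2: "d 2 < 2 * d 1"
    and S: "g 1 = g 0 + d 1" "f 2 = f 1 + d 1" "f 3 = f 2 - d 1" "g 4 = g 3 + d 1" "f 5 = f 4 + d 1"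
  shows False
proof -
  have "linf f g 0 2 = d 2" "linf f g 0 3 = d 3" "linf f g 0 4 = d 4" "linf f g 0 5 = d 5"
    "linf f g 1 3 = d 2" "linf f g 1 4 = d 3" "linf f g 1 5 = d 4" "linf f g 2 4 = d 2"
    "linf f g 3 5 = d 2"
    by (simp_all add: linf_line_dist[OF L])
  moreover have "d 1 \<noteq> d 5"
    by (rule linf_line_inj[OF L]) simp_all
  moreover have "0 < d 1" "0 < d 2" "0 < d 3" "0 < d 4" "0 < d 5"
    by (simp_all add: linf_line_pos[OF L])
  ultimately show False
    using S d2 by (smt (z3))
qed

text \<open>Here \<open>f 2\<close> and \<open>f 4\<close> differ by \<open>d 2\<close>. If
  \<open>f 4\<close> is larger, (1, 5) spans \<open>2 * d 1 + d 2\<close>, out of reach for (0, 4).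
  Otherwise (1, 4) gives \<open>d 3 \<le> d 1\<close>, so (0, 3) forces \<open>g 2 = g 0\<close>,
  and points 0 and 4 coincide.\<close>

lemma no_TRTBR:
  assumes L: "linf_line 5 d f g" and d2: "d 2 < 2 * d 1"
    and S: "g 1 = g 0 + d 1" "f 2 = f 1 + d 1" "g 3 = g 2 + d 1" "g 4 = g 3 - d 1" "f 5 = f 4 + d 1"
  shows False
proof -
  have "linf f g 0 1 = d 1" "linf f g 0 2 = d 2" "linf f g 0 3 = d 3" "linf f g 0 4 = d 4"
    "linf f g 1 2 = d 1" "linf f g 1 4 = d 3" "linf f g 1 5 = d 4" "linf f g 2 4 = d 2"
    by (simp_all add: linf_line_dist[OF L])
  moreover have "0 < d 1" "0 < d 2" "0 < d 3" "0 < d 4"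
    by (simp_all add: linf_line_pos[OF L])
  ultimately show False
    using S d2 by (smt (z3))
qed

text \<open>If \<open>g 5 < g 3\<close>, then (2, 5) is farther apart than (1, 4) can be. Otherwise
  \<open>d 3 = d 2 - d 1\<close>, and \<open>g 2 - g 1\<close>, \<open>f 3 - f 2\<close>,
  \<open>g 3 - g 4\<close> are all forced to \<open>d 2 - d 1\<close>; then
  \<open>g 1 - g 4 = d 1\<close> exceeds \<open>d 3\<close>.\<close>

lemma no_TRBLR:
  assumes L: "linf_line 5 d f g" and d2: "d 2 < 2 * d 1"
    and S: "g 1 = g 0 + d 1" "f 2 = f 1 + d 1" "g 3 = g 2 - d 1" "f 4 = f 3 - d 1" "f 5 = f 4 + d 1"
  shows False
proof -
  have "linf f g 0 2 = d 2" "linf f g 0 3 = d 3" "linf f g 1 3 = d 2" "linf f g 1 4 = d 3"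
    "linf f g 2 4 = d 2" "linf f g 2 5 = d 3" "linf f g 3 5 = d 2"
    by (simp_all add: linf_line_dist[OF L])
  moreover have "0 < d 1" "0 < d 2" "0 < d 3"
    by (simp_all add: linf_line_pos[OF L])
  ultimately show False
    using S d2 by (smt (z3))
qed

text \<open>The second distances bound the sideways components of the three inner steps by
  \<open>d 2 - d 1\<close> and make one of every two consecutive steps extreme. Each combination
  compatible with \<open>d 3\<close> closes up after four steps, so that
  \<open>d 4 = 0\<close>.\<close>

lemma no_TRBLT:
  assumes L: "linf_line 5 d f g" and d2: "d 2 < 2 * d 1"
    and S: "g 1 = g 0 + d 1" "f 2 = f 1 + d 1" "g 3 = g 2 - d 1" "f 4 = f 3 - d 1" "g 5 = g 4 + d 1"
  shows False
proof -
  have "linf f g 0 2 = d 2" "linf f g 0 3 = d 3" "linf f g 0 4 = d 4" "linf f g 1 3 = d 2"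
    "linf f g 1 4 = d 3" "linf f g 1 5 = d 4" "linf f g 2 4 = d 2" "linf f g 2 5 = d 3"
    "linf f g 3 5 = d 2" "linf f g 4 5 = d 1"
    by (simp_all add: linf_line_dist[OF L])
  moreover have "0 < d 1" "0 < d 2" "0 < d 3" "0 < d 4"
    by (simp_all add: linf_line_pos[OF L])
  ultimately show False
    using S d2 by (smt (z3))
qed

text \<open>Each third distance is attained in the coordinate in which two steps advance by
  \<open>d 1\<close>. So the four inner steps have equal sideways components, and points 1, 3, 5 lie
  on a line of slope 1.\<close>

lemma no_TRTRTR:
  assumes L: "linf_line 6 d f g" and d2: "d 2 < 2 * d 1"
    and S: "g 1 = g 0 + d 1" "f 2 = f 1 + d 1" "g 3 = g 2 + d 1" "f 4 = f 3 + d 1"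
      "g 5 = g 4 + d 1" "f 6 = f 5 + d 1"
  shows False
proof -
  have "linf f g 0 1 = d 1" "linf f g 0 2 = d 2" "linf f g 0 3 = d 3" "linf f g 0 5 = d 5"
    "linf f g 1 4 = d 3" "linf f g 1 6 = d 5" "linf f g 2 3 = d 1" "linf f g 2 5 = d 3"
    "linf f g 3 4 = d 1" "linf f g 3 6 = d 3" "linf f g 4 6 = d 2"
    by (simp_all add: linf_line_dist[OF L])
  moreover have "\<not> (f 1 - g 1 = f 3 - g 3 \<and> f 3 - g 3 = f 5 - g 5)"
    by (rule linf_line_noncollinear[OF L]) simp_all
  moreover have "0 < d 1" "0 < d 2" "0 < d 3" "0 < d 5"
    by (simp_all add: linf_line_pos[OF L])
  ultimately show False
    using S d2 by (smt (z3))
qed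

text \<open>The third distances equate the sideways components of the steps from points 1, 2 and 3.
  The pairs (3, 6) and (4, 6) make this value \<open>d 2 - d 1\<close>, also for the step from point
  4, so again points 1, 3, 5 lie on a line of slope 1.\<close>

lemma no_TRTRTB:
  assumes L: "linf_line 6 d f g" and d2: "d 2 < 2 * d 1"
    and S: "g 1 = g 0 + d 1" "f 2 = f 1 + d 1" "g 3 = g 2 + d 1" "f 4 = f 3 + d 1"
      "g 5 = g 4 + d 1" "g 6 = g 5 - d 1"
  shows False
proof -
  have "linf f g 0 2 = d 2" "linf f g 0 5 = d 5" "linf f g 1 4 = d 3" "linf f g 1 6 = d 5"
    "linf f g 2 3 = d 1" "linf f g 2 4 = d 2" "linf f g 2 5 = d 3" "linf f g 3 4 = d 1"
    "linf f g 3 5 = d 2" "linf f g 3 6 = d 3" "linf f g 4 6 = d 2" "linf f g 5 6 = d 1"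
    by (simp_all add: linf_line_dist[OF L])
  moreover have "\<not> (f 1 - g 1 = f 3 - g 3 \<and> f 3 - g 3 = f 5 - g 5)"
    by (rule linf_line_noncollinear[OF L]) simp_all
  moreover have "0 < d 1" "0 < d 2" "0 < d 3" "0 < d 5"
    by (simp_all add: linf_line_pos[OF L])
  ultimately show False
    using S d2 by (smt (z3))
qed

text \<open>As \<open>g 0 = g 2\<close> and \<open>f 4 = f 6\<close>, the pair (0, 6) takes its
  coordinate differences from (0, 4) and (2, 6), so \<open>d 6 \<le> d 4\<close>. If this is strict,
  \<open>g 0 - g 4\<close> and \<open>f 6 - f 2\<close> both equal \<open>d 4\<close>; then (2, 5)
  is farther apart than (0, 3), or \<open>d 4 = 0\<close>.\<close>

lemma no_TBRBRL:
  assumes L: "linf_line 6 d f g" and d2: "d 2 < 2 * d 1"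
    and S: "g 1 = g 0 + d 1" "g 2 = g 1 - d 1" "f 3 = f 2 + d 1" "g 4 = g 3 - d 1"
      "f 5 = f 4 + d 1" "f 6 = f 5 - d 1"
  shows False
proof -
  have "linf f g 0 3 = d 3" "linf f g 0 4 = d 4" "linf f g 0 6 = d 6" "linf f g 2 3 = d 1"
    "linf f g 2 5 = d 3" "linf f g 2 6 = d 4" "linf f g 3 4 = d 1"
    by (simp_all add: linf_line_dist[OF L])
  moreover have "d 4 \<noteq> d 6"
    by (rule linf_line_inj[OF L]) simp_all
  moreover have "0 < d 1" "0 < d 3" "0 < d 4" "0 < d 6"
    by (simp_all add: linf_line_pos[OF L])
  ultimately show False
    using S d2 by (smt (z3))
qed

section \<open>Exclusion of all words of length six when \<open>d 2 < 2 * d 1\<close>\<close>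

lemma no_RTB:
  assumes L: "linf_line 5 d f g" and d2: "d 2 < 2 * d 1"
    and S: "f 1 = f 0 + d 1" "g 2 = g 1 + d 1" "g 3 = g 2 - d 1"
  shows False
proof -
  \<comment> \<open>\<open>L40\<close> is the window of 4 steps starting at point 0,
    \<open>L41\<close> the one starting at point 1; later names follow this pattern.\<close>
  have L40: "linf_line 4 d (\<lambda>i. f (0 + i)) (\<lambda>i. g (0 + i))"
    by (rule linf_line_shift[OF L]) simp
  have L41: "linf_line 4 d (\<lambda>i. f (1 + i)) (\<lambda>i. g (1 + i))"
    by (rule linf_line_shift[OF L]) simp
  show False
  proof (rule linf_line_step[OF L, of 4 3])
    assume c3: "f 4 = f 3 + d 1"
    show False
    proof (rule linf_line_step[OF L, of 5 4])
      assume c4: "f 5 = f 4 + d 1"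
      show False
        using no_repeat[OF L d2, of 4 3 5] S c3 c4 by simp
    next
      assume c4: "f 5 = f 4 - d 1"
      show False
        by (rule no_TBRL[OF L41 d2]) (use S c3 c4 in simp_all)
    next
      assume c4: "g 5 = g 4 + d 1"
      show False
        by (rule no_TRLTR[OF linf_line_swap[OF L] d2]) (use S c3 c4 in simp_all)
    next
      assume c4: "g 5 = g 4 - d 1"
      show False
        by (rule no_TRTBR[OF linf_line_reverse[OF linf_line_uminus2[OF L]] d2])
          (use S c3 c4 in simp_all)
    qed simp_all
  next
    assume c3: "f 4 = f 3 - d 1"
    show False
      by (rule no_TRLB[OF linf_line_swap[OF L40] d2]) (use S c3 in simp_all)
  next
    assume c3: "g 4 = g 3 + d 1"
    show False
      by (rule no_TRLR[OF linf_line_swap[OF L40] d2]) (use S c3 in simp_all)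
  next
    assume c3: "g 4 = g 3 - d 1"
    show False
      using no_repeat[OF L d2, of 3 2 4] S c3 by simp
  qed simp_all
qed

text \<open>A horizontal step before the two opposite ones is excluded by \<open>no_RTB\<close>. If
  a bottom step precedes them, the step after them completes a forbidden word.\<close>

lemma no_opposite:
  assumes L: "linf_line 5 d f g" and d2: "d 2 < 2 * d 1"
    and S: "g 2 = g 1 + d 1" "g 3 = g 2 - d 1"
  shows False
proof -
  have L40: "linf_line 4 d (\<lambda>i. f (0 + i)) (\<lambda>i. g (0 + i))"
    by (rule linf_line_shift[OF L]) simp
  show False
  proof (rule linf_line_step[OF L, of 1 0])
    assume c0: "f 1 = f 0 + d 1"
    show False
      by (rule no_RTB[OF L d2]) (use S c0 in simp_all)
  next
    assume c0: "f 1 = f 0 - d 1"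
    show False
      by (rule no_RTB[OF linf_line_uminus1[OF L] d2]) (use S c0 in simp_all)
  next
    assume c0: "g 1 = g 0 + d 1"
    show False
      using no_repeat[OF L d2, of 1 0 2] S c0 by simp
  next
    assume c0: "g 1 = g 0 - d 1"
    show False
    proof (rule linf_line_step[OF L, of 4 3])
      assume c3: "f 4 = f 3 + d 1"
      show False
        by (rule no_TRLR[OF linf_line_reverse[OF linf_line_uminus1[OF linf_line_swap[OF L40]]] d2])
          (use S c0 c3 in simp_all)
    next
      assume c3: "f 4 = f 3 - d 1"
      show False
        by (rule no_TRLR
              [OF linf_line_reverse[OF linf_line_uminus2[OF linf_line_uminus1[OF linf_line_swap[OF L40]]]] d2])
          (use S c0 c3 in simp_all)
    next
      assume c3: "g 4 = g 3 + d 1"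
      show False
        by (rule no_TBTB[OF linf_line_uminus2[OF L40]]) (use S c0 c3 in simp_all)
    next
      assume c3: "g 4 = g 3 - d 1"
      show False
        using no_repeat[OF L d2, of 3 2 4] S c0 c3 by simp
    qed simp_all
  qed simp_all
qed

text \<open>With opposite neighbours excluded, vertical and horizontal steps alternate. The turn TRB
  closes after at most two more steps; the staircase TRTR may also need the step before it, which is
  where the words of length six enter.\<close>

lemma no_TR:
  assumes L: "linf_line 6 d f g" and d2: "d 2 < 2 * d 1"
    and S: "g 2 = g 1 + d 1" "f 3 = f 2 + d 1"
  shows False
proof -
  have L40: "linf_line 4 d (\<lambda>i. f (0 + i)) (\<lambda>i. g (0 + i))"
    by (rule linf_line_shift[OF L]) simp
  have L41: "linf_line 4 d (\<lambda>i. f (1 + i)) (\<lambda>i. g (1 + i))"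
    by (rule linf_line_shift[OF L]) simp
  have L42: "linf_line 4 d (\<lambda>i. f (2 + i)) (\<lambda>i. g (2 + i))"
    by (rule linf_line_shift[OF L]) simp
  have L50: "linf_line 5 d (\<lambda>i. f (0 + i)) (\<lambda>i. g (0 + i))"
    by (rule linf_line_shift[OF L]) simp
  have L51: "linf_line 5 d (\<lambda>i. f (1 + i)) (\<lambda>i. g (1 + i))"
    by (rule linf_line_shift[OF L]) simp
  show False
  proof (rule linf_line_step[OF L, of 4 3])
    assume c3: "f 4 = f 3 + d 1"
    show False
      using no_repeat[OF L d2, of 3 2 4] S c3 by simp
  next
    assume c3: "f 4 = f 3 - d 1"
    show False
      by (rule no_opposite
            [OF linf_line_reverse[OF linf_line_uminus2[OF linf_line_swap[OF L50]]] d2])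
        (use S c3 in simp_all)
  next
    assume c3: "g 4 = g 3 + d 1"
    show False
    proof (rule linf_line_step[OF L, of 5 4])
      assume c4: "f 5 = f 4 + d 1"
      show False
      proof (rule linf_line_step[OF L, of 6 5])
        assume c5: "f 6 = f 5 + d 1"
        show False
          using no_repeat[OF L d2, of 5 4 6] S c3 c4 c5 by simp
      next
        assume c5: "f 6 = f 5 - d 1"
        show False
        proof (rule linf_line_step[OF L, of 1 0])
          assume c0: "f 1 = f 0 + d 1"
          show False
            by (rule no_TRTRTB[OF linf_line_swap[OF L] d2]) (use S c3 c4 c5 c0 in simp_all)
        next
          assume c0: "f 1 = f 0 - d 1"
          show False
            by (rule no_TRTL[OF linf_line_reverse[OF L40] d2]) (use S c3 c4 c5 c0 in simp_all)
        next
          assume c0: "g 1 = g 0 + d 1"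
          show False
            using no_repeat[OF L d2, of 1 0 2] S c3 c4 c5 c0 by simp
        next
          assume c0: "g 1 = g 0 - d 1"
          show False
            by (rule no_TBRBRL[OF linf_line_uminus2[OF L] d2]) (use S c3 c4 c5 c0 in simp_all)
        qed simp_all
      next
        assume c5: "g 6 = g 5 + d 1"
        show False
        proof (rule linf_line_step[OF L, of 1 0])
          assume c0: "f 1 = f 0 + d 1"
          show False
            by (rule no_TRTRTR[OF linf_line_swap[OF L] d2]) (use S c3 c4 c5 c0 in simp_all)
        next
          assume c0: "f 1 = f 0 - d 1"
          show False
            by (rule no_TRTL[OF linf_line_reverse[OF L40] d2]) (use S c3 c4 c5 c0 in simp_all)
        next
          assume c0: "g 1 = g 0 + d 1"
          show False
            using no_repeat[OF L d2, of 1 0 2] S c3 c4 c5 c0 by simp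
        next
          assume c0: "g 1 = g 0 - d 1"
          show False
            by (rule no_TRTRTB[OF linf_line_reverse[OF L] d2]) (use S c3 c4 c5 c0 in simp_all)
        qed simp_all
      next
        assume c5: "g 6 = g 5 - d 1"
        show False
          by (rule no_TRTL[OF linf_line_swap[OF L42] d2]) (use S c3 c4 c5 in simp_all)
      qed simp_all
    next
      assume c4: "f 5 = f 4 - d 1"
      show False
        by (rule no_TRTL[OF L41 d2]) (use S c3 c4 in simp_all)
    next
      assume c4: "g 5 = g 4 + d 1"
      show False
        using no_repeat[OF L d2, of 4 3 5] S c3 c4 by simp
    next
      assume c4: "g 5 = g 4 - d 1"
      show False
        by (rule no_opposite[OF linf_line_reverse[OF linf_line_uminus2[OF L51]] d2])
          (use S c3 c4 in simp_all)
    qed simp_all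
  next
    assume c3: "g 4 = g 3 - d 1"
    show False
    proof (rule linf_line_step[OF L, of 5 4])
      assume c4: "f 5 = f 4 + d 1"
      show False
        by (rule no_TRTL[OF linf_line_reverse[OF linf_line_uminus1[OF linf_line_swap[OF L41]]] d2])
          (use S c3 c4 in simp_all)
    next
      assume c4: "f 5 = f 4 - d 1"
      show False
      proof (rule linf_line_step[OF L, of 6 5])
        assume c5: "f 6 = f 5 + d 1"
        show False
          by (rule no_TRBLR[OF L51 d2]) (use S c3 c4 c5 in simp_all)
      next
        assume c5: "f 6 = f 5 - d 1"
        show False
          using no_repeat[OF L d2, of 5 4 6] S c3 c4 c5 by simp
      next
        assume c5: "g 6 = g 5 + d 1"
        show False
          by (rule no_TRBLT[OF L51 d2]) (use S c3 c4 c5 in simp_all)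
      next
        assume c5: "g 6 = g 5 - d 1"
        show False
          by (rule no_TRTL
                [OF linf_line_reverse[OF linf_line_uminus2[OF linf_line_uminus1[OF L42]]] d2])
            (use S c3 c4 c5 in simp_all)
      qed simp_all
    next
      assume c4: "g 5 = g 4 + d 1"
      show False
        by (rule no_opposite[OF linf_line_reverse[OF L51] d2]) (use S c3 c4 in simp_all)
    next
      assume c4: "g 5 = g 4 - d 1"
      show False
        using no_repeat[OF L d2, of 4 3 5] S c3 c4 by simp
    qed simp_all
  qed simp_all
qed

lemma no_T:
  assumes L: "linf_line 6 d f g" and d2: "d 2 < 2 * d 1"
    and S: "g 2 = g 1 + d 1"
  shows False
proof -
  have L50: "linf_line 5 d (\<lambda>i. f (0 + i)) (\<lambda>i. g (0 + i))"
    by (rule linf_line_shift[OF L]) simp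
  show False
  proof (rule linf_line_step[OF L, of 3 2])
    assume c2: "f 3 = f 2 + d 1"
    show False
      by (rule no_TR[OF L d2]) (use S c2 in simp_all)
  next
    assume c2: "f 3 = f 2 - d 1"
    show False
      by (rule no_TR[OF linf_line_uminus1[OF L] d2]) (use S c2 in simp_all)
  next
    assume c2: "g 3 = g 2 + d 1"
    show False
      using no_repeat[OF L d2, of 2 1 3] S c2 by simp
  next
    assume c2: "g 3 = g 2 - d 1"
    show False
      by (rule no_opposite[OF L50 d2]) (use S c2 in simp_all)
  qed simp_all
qed

text \<open>A symmetry of the square moves the step from point 1 to point 2 to the top side.\<close>

lemma linf_line_second_distance_ge:
  assumes L: "linf_line 6 d f g" and d2: "d 2 < 2 * d 1"
  shows False
proof -
  show False
  proof (rule linf_line_step[OF L, of 2 1])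
    assume c1: "f 2 = f 1 + d 1"
    show False
      by (rule no_T[OF linf_line_swap[OF L] d2]) (use c1 in simp_all)
  next
    assume c1: "f 2 = f 1 - d 1"
    show False
      by (rule no_T[OF linf_line_uminus2[OF linf_line_swap[OF L]] d2]) (use c1 in simp_all)
  next
    assume c1: "g 2 = g 1 + d 1"
    show False
      by (rule no_T[OF L d2]) (use c1 in simp_all)
  next
    assume c1: "g 2 = g 1 - d 1"
    show False
      by (rule no_T[OF linf_line_uminus2[OF L] d2]) (use c1 in simp_all)
  qed simp_all
qed

section \<open>Propagation of one side when \<open>d 2 = 2 * d 1\<close>\<close>

text \<open>Consecutive steps share a side, so the run can leave the top only at a corner step. Two
  equal corner steps are collinear, so this makes \<open>d 3 < 3 * d 1\<close>, whereas three steps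
  on one side give \<open>3 * d 1\<close>. Two different adjacent corner steps lead to such a triple
  again or to \<open>d 3 = d 1\<close>.\<close>

lemma linf_line_6_extend_step:
  assumes L: "linf_line 6 d f g" and d2: "d 2 = 2 * d 1"
    and S: "g 3 = g 2 + d 1" "g 4 = g 3 + d 1"
  shows "g 1 = g 0 + d 1 \<and> g 2 = g 1 + d 1 \<and> g 5 = g 4 + d 1 \<and> g 6 = g 5 + d 1"
proof -
  have "linf f g 0 1 = d 1" "linf f g 1 2 = d 1" "linf f g 2 3 = d 1"
    "linf f g 3 4 = d 1" "linf f g 4 5 = d 1" "linf f g 5 6 = d 1"
    "linf f g 0 2 = d 2" "linf f g 1 3 = d 2" "linf f g 2 4 = d 2"
    "linf f g 3 5 = d 2" "linf f g 4 6 = d 2"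
    "linf f g 0 3 = d 3" "linf f g 1 4 = d 3" "linf f g 2 5 = d 3" "linf f g 3 6 = d 3"
    by (simp_all add: linf_line_dist[OF L])
  moreover have "0 < d 1" "d 3 \<noteq> d 1"
    using linf_line_pos[OF L, of 1] linf_line_inj[OF L, of 3 1] by simp_all
  moreover have "\<not> (f i + g i = f j + g j \<and> f j + g j = f k + g k)"
    "\<not> (f i - g i = f j - g j \<and> f j - g j = f k - g k)"
    if "(i, j, k) \<in> {(0,1,2),(1,2,3),(2,3,4),(3,4,5),(4,5,6)}" for i j k
    using linf_line_noncollinear[OF L, of i j k] that by auto
  note this[of 0 1 2, simplified] this[of 1 2 3, simplified] this[of 2 3 4, simplified]
    this[of 3 4 5, simplified] this[of 4 5 6, simplified]
  ultimately show ?thesis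
    using S d2 by (smt (verit))
qed

lemma linf_line_6_straight:
  assumes L: "linf_line 6 d f g"
  shows "\<exists>h\<in>{f, \<lambda>i. - f i, g, \<lambda>i. - g i}. \<forall>i<6. h (i + 1) = h i + d 1"
proof -
  have D: "linf f g 2 3 = d 1" "linf f g 3 4 = d 1" "linf f g 2 4 = d 2"
    by (simp_all add: linf_line_dist[OF L])
  \<comment> \<open>The bound \<open>d 2 \<le> 2 * d 1\<close> is the triangle inequality for the
    two middle steps.\<close>
  have d2: "d 2 = 2 * d 1"
    using linf_line_second_distance_ge[OF L] D by (smt (verit))
  have straight: "\<forall>i<6. k (i + 1) = k i + d 1"
    if "linf_line 6 d h k" "k 3 = k 2 + d 1" "k 4 = k 3 + d 1" for h k
  proof -
    have "{..<6} = {0, 1, 2, 3, 4, 5 :: nat}" by auto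
    then have "(\<forall>i<6. k (i + 1) = k i + d 1) \<longleftrightarrow> (\<forall>i\<in>{0, 1, 2, 3, 4, 5}. k (i + 1) = k i + d 1)"
      by (metis lessThan_iff)
    then show ?thesis
      using linf_line_6_extend_step[OF that(1) d2 that(2,3)] that(2,3) by simp
  qed
  note swap = linf_line_swap[OF L]
  \<comment> \<open>Equality in the triangle inequality puts both middle steps on a common
    side.\<close>
  consider "f 3 = f 2 + d 1" "f 4 = f 3 + d 1" | "f 3 = f 2 - d 1" "f 4 = f 3 - d 1"
    | "g 3 = g 2 + d 1" "g 4 = g 3 + d 1" | "g 3 = g 2 - d 1" "g 4 = g 3 - d 1"
    using D d2 by (smt (verit))
  then show ?thesis
  proof cases
    case 1
    then show ?thesis using straight[OF swap] by blast
  next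
    case 2
    then show ?thesis using straight[OF linf_line_uminus2[OF swap]] by simp
  next
    case 3
    then show ?thesis using straight[OF L] by blast
  next
    case 4
    then show ?thesis using straight[OF linf_line_uminus2[OF L]] by simp
  qed
qed

section \<open>Gluing overlapping windows\<close>

lemma linf_line_straight:
  assumes "6 \<le> m" "linf_line m d f g"
  shows "\<exists>h\<in>{f, \<lambda>i. - f i, g, \<lambda>i. - g i}. \<forall>i<m. h (i + 1) = h i + d 1"
  using assms
proof (induction m rule: nat_induct_at_least)
  case base
  then show ?case by (rule linf_line_6_straight)
next
  case (Suc m)
  have "linf_line m d f g"
    using linf_line_shift[OF Suc.prems, of 0 m] by simp
  then obtain h where h: "h \<in> {f, \<lambda>i. - f i, g, \<lambda>i. - g i}" "\<And>i. i < m \<Longrightarrow> h (i + 1) = h i + d 1"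
    using Suc.IH by blast
  \<comment> \<open>The last seven points start at \<open>j\<close>; this window shares its first
    five steps with the induction hypothesis, and two of them suffice.\<close>
  define j where "j = m - 5"
  have j: "m = j + 5" using Suc.hyps by (simp add: j_def)
  have "linf_line 6 d (\<lambda>i. f (j + i)) (\<lambda>i. g (j + i))"
    using linf_line_shift[OF Suc.prems, of j 6] j by simp
  from linf_line_6_straight[OF this]
  have
    "\<exists>k\<in>{f, \<lambda>i. - f i, g, \<lambda>i. - g i}. \<forall>i<6. k (j + i + 1) = k (j + i) + d 1"
    by (simp add: add.assoc)
  then obtain k where k: "k \<in> {f, \<lambda>i. - f i, g, \<lambda>i. - g i}"
    "\<And>i. i < 6 \<Longrightarrow> k (j + i + 1) = k (j + i) + d 1"
    by blast
  have hk: "h (j + 1) = h j + d 1" "h (j + 1 + 1) = h (j + 1) + d 1"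
    "k (j + 1) = k j + d 1" "k (j + 1 + 1) = k (j + 1) + d 1"
    using h(2)[of j] h(2)[of "j + 1"] k(2)[of 0] k(2)[of 1] j by simp_all
  have pos: "0 < d 1"
    using linf_line_pos[OF Suc.prems, of 1] by simp
  have nc: "\<not> (f j + g j = f (j + 1) + g (j + 1) \<and> f (j + 1) + g (j + 1) = f (j + 1 + 1) + g (j + 1 + 1))"
    "\<not> (f j - g j = f (j + 1) - g (j + 1) \<and> f (j + 1) - g (j + 1) = f (j + 1 + 1) - g (j + 1 + 1))"
    by (rule linf_line_noncollinear[OF Suc.prems]; use j in simp)+
  \<comment> \<open>Opposite sides contradict \<open>0 < d 1\<close>; adjacent sides make both
    shared steps run along the same diagonal, which gives three collinear points.\<close>
  have "k = h"
  proof (rule ccontr)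
    assume "k \<noteq> h"
    with h(1) k(1) show False
      by (elim insertE emptyE) (use \<open>k \<noteq> h\<close> hk pos nc in simp_all)
  qed
  then have "h (m + 1) = h m + d 1"
    using k(2)[of 5] j by simp
  then show ?case
    using h by (auto simp: less_Suc_eq)
qed

section \<open>Passage between planar configurations and indexed coordinates\<close>

lemma arithmetic_progression:
  fixes h :: "nat \<Rightarrow> real"
  assumes "\<And>i. i < m \<Longrightarrow> h (i + 1) = h i + s" "i \<le> m"
  shows "h i = h 0 + real i * s"
  using assms(2) by (induction i) (use assms(1) in \<open>auto simp: algebra_simps simp flip: Suc_eq_plus1\<close>)

lemma collinear_on_hyperplane:
  fixes T :: "(real^2) set"
  assumes "a \<noteq> 0" "\<And>x. x \<in> T \<Longrightarrow> a \<bullet> x = c"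
  shows "collinear T"
proof -
  have "collinear {x. a \<bullet> x = c}"
    using assms(1) by (simp add: collinear_aff_dim aff_dim_hyperplane)
  then show ?thesis
    by (rule collinear_subset) (use assms(2) in auto)
qed

lemma line_like_crescent_config_linf_line:
  assumes "line_like_crescent_config n S" "2 \<le> n"
  obtains P d where "bij_betw P {1..n} S"
    "linf_line (n - 1) d (\<lambda>i. P (i + 1) $ 1) (\<lambda>i. P (i + 1) $ 2)"
proof -
  have nc: "\<not> collinear T" if "T \<subseteq> S" "card T = 3" for T
    using assms(1) that by (simp add: line_like_crescent_config_def)
  obtain \<phi> :: "real^2 \<Rightarrow> nat" where \<phi>: "bij_betw \<phi> S {1..n}"
    and "\<forall>a\<in>S. \<forall>b\<in>S. \<forall>c\<in>S. \<forall>e\<in>S. infnorm (a - b) = infnorm (c - e) \<longleftrightarrow>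
      \<bar>int (\<phi> a) - int (\<phi> b)\<bar> = \<bar>int (\<phi> c) - int (\<phi> e)\<bar>"
    using assms(1) unfolding line_like_crescent_config_def line_like_config_def by (elim conjE exE)
  then have dist: "infnorm (a - b) = infnorm (c - e) \<longleftrightarrow>
      \<bar>int (\<phi> a) - int (\<phi> b)\<bar> = \<bar>int (\<phi> c) - int (\<phi> e)\<bar>"
    if "a \<in> S" "b \<in> S" "c \<in> S" "e \<in> S" for a b c e
    using that by simp
  define P where "P = inv_into S \<phi>"
  \<comment> \<open>Distances depend only on index differences, so the pairs with the first point
    represent them all.\<close>
  define d where "d k = infnorm (P (k + 1) - P 1)" for k
  have P: "bij_betw P {1..n} S"
    unfolding P_def using \<phi> by (rule bij_betw_inv_into)
  have PS: "P i \<in> S" if "1 \<le> i" "i \<le> n" for i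
    using bij_betwE[OF P] that by simp
  have \<phi>P: "\<phi> (P i) = i" if "1 \<le> i" "i \<le> n" for i
    using \<phi> that by (simp add: P_def bij_betw_inv_into_right)
  have P_eq: "P i = P j \<longleftrightarrow> i = j" if "1 \<le> i" "i \<le> n" "1 \<le> j" "j \<le> n" for i j
    using \<phi>P that by metis
  have "linf_line (n - 1) d (\<lambda>i. P (i + 1) $ 1) (\<lambda>i. P (i + 1) $ 2)"
  proof (rule linf_lineI)
    show "inj_on d {1..n - 1}"
    proof (rule inj_onI)
      fix k l assume "k \<in> {1..n - 1}" "l \<in> {1..n - 1}" "d k = d l"
      then show "k = l"
        using dist[of "P (k + 1)" "P 1" "P (l + 1)" "P 1"] assms(2)
        by (auto simp: d_def PS \<phi>P)
    qed
  next
    fix k assume "1 \<le> k" "k \<le> n - 1"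
    then show "0 < d k"
      using P_eq[of "k + 1" 1] by (simp add: d_def infnorm_pos_lt)
  next
    fix i j assume "i < j" "j \<le> n - 1"
    then have "infnorm (P (j + 1) - P (i + 1)) = d (j - i)"
      using dist[of "P (j + 1)" "P (i + 1)" "P (j - i + 1)" "P 1"]
      by (auto simp: d_def PS \<phi>P)
    then show "linf (\<lambda>i. P (i + 1) $ 1) (\<lambda>i. P (i + 1) $ 2) i j = d (j - i)"
      by (simp add: infnorm_real2)
  next
    fix i j k u v c
    assume ijk: "i < j" "j < k" "k \<le> n - 1"
      and on: "u * P (i + 1) $ 1 + v * P (i + 1) $ 2 = c"
        "u * P (j + 1) $ 1 + v * P (j + 1) $ 2 = c" "u * P (k + 1) $ 1 + v * P (k + 1) $ 2 = c"
    define a :: "real^2" where "a = vector [u, v]"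
    let ?T = "{P (i + 1), P (j + 1), P (k + 1)}"
    have "\<not> collinear ?T"
      by (rule nc) (use ijk in \<open>auto simp: PS P_eq\<close>)
    moreover have "a \<bullet> x = c" if "x \<in> ?T" for x
      using on that by (auto simp: a_def inner_vec_def sum_2)
    ultimately have "a = 0"
      using collinear_on_hyperplane by blast
    then show "u = 0 \<and> v = 0"
      by (simp add: a_def vec_eq_iff forall_2)
  qed
  with P show ?thesis by (rule that)
qed

text \<open>Projection onto the first coordinate axis keeps the first coordinate, so the projected
  points inherit its constant increment.\<close>

lemma perpendicular_perturbation_horizontal:
  assumes "bij_betw P {1..n} S" "s \<noteq> 0"
    and "\<And>i. i \<in> {1..n} \<Longrightarrow> P i $ 1 = P 1 $ 1 + (real i - 1) * s"
  shows "perpendicular_perturbation n S {p. p $ 2 = 0}"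
  unfolding perpendicular_perturbation_def
proof (intro conjI exI)
  show "is_line {p :: real^2. p $ 2 = 0}"
    by (rule horizontal_line_is_line) (auto simp: horizontal_line_def)
  let ?Q = "\<lambda>i. vector [P i $ 1, 0] :: real^2"
  let ?v = "vector [s, 0] :: real^2"
  show "bij_betw P {1..n} S" by fact
  show "?v \<noteq> 0" using assms(2) by (simp add: vec_eq_iff forall_2)
  show "\<forall>x\<in>{p. p $ 2 = 0}. x + ?v \<in> {p. p $ 2 = 0}" by simp
  show "\<forall>i\<in>{1..n}. ?Q i \<in> {p. p $ 2 = 0} \<and> ?Q i = ?Q 1 + (real i - 1) *\<^sub>R ?v"
  proof
    fix i assume "i \<in> {1..n}"
    then show "?Q i \<in> {p. p $ 2 = 0} \<and> ?Q i = ?Q 1 + (real i - 1) *\<^sub>R ?v"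
      using assms(3)[of i] by (simp add: vec_eq_iff forall_2)
  qed
  show "\<forall>i\<in>{1..n}. orthogonal_projection {p. p $ 2 = 0} (P i) (?Q i)"
    by (simp add: orthogonal_projection_def orthogonal_def inner_vec_def sum_2)
qed

lemma perpendicular_perturbation_vertical:
  assumes "bij_betw P {1..n} S" "s \<noteq> 0"
    and "\<And>i. i \<in> {1..n} \<Longrightarrow> P i $ 2 = P 1 $ 2 + (real i - 1) * s"
  shows "perpendicular_perturbation n S {p. p $ 1 = 0}"
  unfolding perpendicular_perturbation_def
proof (intro conjI exI)
  show "is_line {p :: real^2. p $ 1 = 0}"
    by (rule vertical_line_is_line) (auto simp: vertical_line_def)
  let ?Q = "\<lambda>i. vector [0, P i $ 2] :: real^2"
  let ?v = "vector [0, s] :: real^2"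
  show "bij_betw P {1..n} S" by fact
  show "?v \<noteq> 0" using assms(2) by (simp add: vec_eq_iff forall_2)
  show "\<forall>x\<in>{p. p $ 1 = 0}. x + ?v \<in> {p. p $ 1 = 0}" by simp
  show "\<forall>i\<in>{1..n}. ?Q i \<in> {p. p $ 1 = 0} \<and> ?Q i = ?Q 1 + (real i - 1) *\<^sub>R ?v"
  proof
    fix i assume "i \<in> {1..n}"
    then show "?Q i \<in> {p. p $ 1 = 0} \<and> ?Q i = ?Q 1 + (real i - 1) *\<^sub>R ?v"
      using assms(3)[of i] by (simp add: vec_eq_iff forall_2)
  qed
  show "\<forall>i\<in>{1..n}. orthogonal_projection {p. p $ 1 = 0} (P i) (?Q i)"
    by (simp add: orthogonal_projection_def orthogonal_def inner_vec_def sum_2)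
qed

theorem theorem1p5:
  fixes n :: nat and S :: "(real^2) set"
  assumes "n \<ge> 7"
    and "line_like_crescent_config n S"
  shows "\<exists>l. (horizontal_line l \<or> vertical_line l) \<and> perpendicular_perturbation n S l"
proof -
  obtain P d where P: "bij_betw P {1..n} S"
    and L: "linf_line (n - 1) d (\<lambda>i. P (i + 1) $ 1) (\<lambda>i. P (i + 1) $ 2)" (is "linf_line _ _ ?f ?g")
    using line_like_crescent_config_linf_line[OF assms(2)] assms(1) by auto
  have "0 < d 1"
    by (rule linf_line_pos[OF L]) (use assms(1) in auto)
  then have d1: "d 1 \<noteq> 0" "- d 1 \<noteq> 0" by linarith+
  have "6 \<le> n - 1" using assms(1) by simp
  then obtain h where h: "h \<in> {?f, \<lambda>i. - ?f i, ?g, \<lambda>i. - ?g i}"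
    and "\<And>i. i < n - 1 \<Longrightarrow> h (i + 1) = h i + d 1"
    using linf_line_straight[OF _ L] by blast
  then have *: "h (i - 1) = h 0 + (real i - 1) * d 1" if "i \<in> {1..n}" for i
    using arithmetic_progression[of "n - 1" h "d 1" "i - 1"] that diff_le_mono[of i n 1]
    by (simp add: of_nat_diff)
  \<comment> \<open>The sign of the side is absorbed into \<open>s\<close>, which may be
    negative.\<close>
  consider (f) s where "s \<noteq> 0" "\<And>i. i \<in> {1..n} \<Longrightarrow> P i $ 1 = P 1 $ 1 + (real i - 1) * s"
    | (g) s where "s \<noteq> 0" "\<And>i. i \<in> {1..n} \<Longrightarrow> P i $ 2 = P 1 $ 2 + (real i - 1) * s"
    using h
  proof (elim insertE emptyE)
    assume h_eq: "h = ?f"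
    have "P i $ 1 = P 1 $ 1 + (real i - 1) * d 1" if "i \<in> {1..n}" for i
      using *[OF that] that by (simp add: h_eq)
    then show ?thesis by (rule f[OF d1(1)])
  next
    assume h_eq: "h = (\<lambda>i. - ?f i)"
    have "P i $ 1 = P 1 $ 1 + (real i - 1) * - d 1" if "i \<in> {1..n}" for i
      using *[OF that] that by (simp add: h_eq)
    then show ?thesis by (rule f[OF d1(2)])
  next
    assume h_eq: "h = ?g"
    have "P i $ 2 = P 1 $ 2 + (real i - 1) * d 1" if "i \<in> {1..n}" for i
      using *[OF that] that by (simp add: h_eq)
    then show ?thesis by (rule g[OF d1(1)])
  next
    assume h_eq: "h = (\<lambda>i. - ?g i)"
    have "P i $ 2 = P 1 $ 2 + (real i - 1) * - d 1" if "i \<in> {1..n}" for i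
      using *[OF that] that by (simp add: h_eq)
    then show ?thesis by (rule g[OF d1(2)])
  qed
  then show ?thesis
  proof cases
    case f
    then show ?thesis
      using perpendicular_perturbation_horizontal[OF P f] unfolding horizontal_line_def by blast
  next
    case g
    then show ?thesis
      using perpendicular_perturbation_vertical[OF P g] unfolding vertical_line_def by blast
  qed
qed

end
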